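(* Let $n \geq 1$ and let $K, L \subseteq \mathbb{R}^n$ be compact convex sets with non-empty interiors. Then the equality $$V_n((1-\lambda)K + \lambda L)^{1/n} = (1-\lambda)V_n(K)^{1/n} + \lambda V_n(L)^{1/n}$$ holds for some $\lambda \in (0,1)$ if and only if $K$ and $L$ are homothetic.
   Context: $V_n$ denotes $n$-dimensional Euclidean volume (Lebesgue measure) on $\mathbb{R}^n$. For $K, L \subseteq \mathbb{R}^n$ and $a, b \geq 0$, the Minkowski combination is $aK + bL = \{ax + by \mid x \in K,\ y \in L\}$. Two sets $K$ and $L$ are homothetic if $K = aL + x$ for some real $a > 0$ and some point $x \in \mathbb{R}^n$. The Brunn-Minkowski inequality asserts that $V_n((1-\lambda)K + \lambda L)^{1/n} \geq (1-\lambda)V_n(K)^{1/n} + \lambda V_n(L)^{1/n}$ for all compact convex $K, L$ and all $\lambda \in [0,1]$. *)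

theory Defs
  imports "HOL-Analysis.Analysis"
begin

definition minkowski_comb ::
    "real \<Rightarrow> 'a::real_vector set \<Rightarrow> real \<Rightarrow> 'a set \<Rightarrow> 'a set" where
  "minkowski_comb a K b L = {a *\<^sub>R x + b *\<^sub>R y | x y. x \<in> K \<and> y \<in> L}"

definition homothetic :: "'a::real_vector set \<Rightarrow> 'a set \<Rightarrow> bool" where
  "homothetic K L \<longleftrightarrow> (\<exists>a>0. \<exists>x. K = (\<lambda>y. a *\<^sub>R y + x) ` L)"

end

theory Submission
  imports Defs "HOL-Probability.Distribution_Functions"
begin

text \<open>
  The Brunn--Minkowski inequality is obtained by the method of Hadwiger and Ohmann: for two finite
  unions of disjoint boxes, cut the first by a coordinate hyperplane separating two of its boxes,
  cut the second in the same volume ratio, and induct on the number of boxes.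

  For equality, normalise the bodies to volume \<open>1\<close> and let \<open>p t\<close> and \<open>q t\<close> be the levels below
  which, in a fixed direction \<open>u\<close>, the bodies \<open>A\<close> and \<open>B\<close> have volume \<open>t ^ n\<close>. Cutting both bodies
  and applying the inequality to the pieces shows that \<open>a * p s + b * q t\<close>, restricted to
  \<open>a * s + b * t = (a + b) * w\<close>, is minimal at \<open>s = t = w\<close>. This minimality is integrated over
  \<open>w\<close>, which replaces the unavailable derivatives of \<open>p\<close> and \<open>q\<close> by those of their
  antiderivatives; differentiating along the constraint yields that \<open>p - q\<close> is constant. The
  constant is the \<open>u\<close>-component of the difference of the centroids. Hence, after matching the
  centroids, every halfspace cuts off the same volume from both bodies, and they coincide.
\<close>

section \<open>Volumes cut off by halfspaces\<close>

abbreviation vol :: "'a::euclidean_space set \<Rightarrow> real" where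
  "vol \<equiv> measure lebesgue"

text \<open>Pushing Lebesgue measure on \<open>A\<close> forward along \<open>u\<close> turns the
  volume below a level into a distribution function, so the theory of such functions
  applies.\<close>

lemma finite_borel_measure_projection:
  fixes A :: "'a::euclidean_space set"
  assumes "A \<in> lmeasurable"
  shows "finite_borel_measure (distr (lebesgue_on A) borel (\<lambda>x. u \<bullet> x))"
proof -
  interpret finite_measure "lebesgue_on A"
    using assms by (rule finite_measure_lebesgue_on)
  have "(\<lambda>x. u \<bullet> x) \<in> borel_measurable (lebesgue_on A)"
    by (intro continuous_imp_measurable_on_sets_lebesgue continuous_intros) (use assms in auto)
  then show ?thesis
    by (simp add: finite_borel_measure_def finite_borel_measure_axioms_def finite_measure_distr)
qed

lemma measure_projection:
  fixes A :: "'a::euclidean_space set"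
  assumes "A \<in> lmeasurable" "X \<in> sets borel"
  shows "measure (distr (lebesgue_on A) borel (\<lambda>x. u \<bullet> x)) X = vol (A \<inter> {x. u \<bullet> x \<in> X})"
proof -
  have "(\<lambda>x. u \<bullet> x) \<in> borel_measurable (lebesgue_on A)"
    by (intro continuous_imp_measurable_on_sets_lebesgue continuous_intros) (use assms in auto)
  then show ?thesis
    using assms by (subst measure_distr) (auto simp: measure_restrict_space vimage_def Int_commute)
qed

text \<open>A distribution function is continuous wherever it has no atom. The atom at
  \<open>s\<close> is the volume of a hyperplane section, which is null because \<open>u\<close> is
  nonzero.\<close>

lemma continuous_on_vol_halfspace:
  fixes A :: "'a::euclidean_space set"
  assumes A: "A \<in> lmeasurable" and "u \<noteq> 0"
  shows "continuous_on S (\<lambda>s. vol (A \<inter> {x. u \<bullet> x \<le> s}))"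
proof -
  let ?D = "distr (lebesgue_on A) borel (\<lambda>x. u \<bullet> x)"
  interpret finite_borel_measure ?D
    using A by (rule finite_borel_measure_projection)
  have "cdf ?D s = vol (A \<inter> {x. u \<bullet> x \<le> s})" for s
    using measure_projection[OF A, of "{..s}" u] by (simp add: cdf_def)
  moreover have "isCont (cdf ?D) s" for s
  proof -
    have "negligible (A \<inter> {x. u \<bullet> x = s})"
      using \<open>u \<noteq> 0\<close> by (intro negligible_subset[OF negligible_hyperplane[of u s]]) auto
    then show ?thesis
      using measure_projection[OF A, of "{s}" u] by (simp add: isCont_cdf negligible_imp_measure0)
  qed
  ultimately show ?thesis
    by (metis (no_types, lifting) continuous_at_imp_continuous_on continuous_on_cong)
qed

lemma vol_halfspace_split:
  fixes A :: "'a::euclidean_space set"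
  assumes A: "A \<in> lmeasurable" and "u \<noteq> 0"
  shows "vol (A \<inter> {x. u \<bullet> x < s}) = vol (A \<inter> {x. u \<bullet> x \<le> s})"
    and "vol (A \<inter> {x. u \<bullet> x \<ge> s}) = vol A - vol (A \<inter> {x. u \<bullet> x \<le> s})"
    and "vol (A \<inter> {x. u \<bullet> x > s}) = vol A - vol (A \<inter> {x. u \<bullet> x \<le> s})"
proof -
  have neg: "negligible {x. u \<bullet> x = s}"
    using \<open>u \<noteq> 0\<close> by (intro negligible_hyperplane) auto
  have lm: "A \<inter> X \<in> lmeasurable" if "X \<in> sets borel" for X
    using A that by (intro fmeasurable_Int_fmeasurable) auto
  have H: "{x. u \<bullet> x \<le> s} \<in> sets borel" "{x. u \<bullet> x < s} \<in> sets borel"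
      "{x. u \<bullet> x > s} \<in> sets borel" "{x. u \<bullet> x \<ge> s} \<in> sets borel"
    by measurable
  show "vol (A \<inter> {x. u \<bullet> x < s}) = vol (A \<inter> {x. u \<bullet> x \<le> s})"
    by (intro measure_negligible_symdiff lm H negligible_subset[OF neg]) auto
  have disj: "(A \<inter> {x. u \<bullet> x \<le> s}) \<inter> (A \<inter> {x. u \<bullet> x > s}) = {}"
    by auto
  have "vol (A \<inter> {x. u \<bullet> x \<le> s} \<union> A \<inter> {x. u \<bullet> x > s}) = 
      vol (A \<inter> {x. u \<bullet> x \<le> s}) + vol (A \<inter> {x. u \<bullet> x > s})"
    by (subst measure_Un3[OF lm lm]) (use H disj in auto)
  moreover have "A \<inter> {x. u \<bullet> x \<le> s} \<union> A \<inter> {x. u \<bullet> x > s} = A" by auto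
  ultimately show *: "vol (A \<inter> {x. u \<bullet> x > s}) = vol A - vol (A \<inter> {x. u \<bullet> x \<le> s})"
    by simp
  have "vol (A \<inter> {x. u \<bullet> x \<ge> s}) = vol (A \<inter> {x. u \<bullet> x > s})"
    by (intro measure_negligible_symdiff lm H negligible_subset[OF neg]) auto
  with * show "vol (A \<inter> {x. u \<bullet> x \<ge> s}) = vol A - vol (A \<inter> {x. u \<bullet> x \<le> s})"
    by simp
qed

lemma obtain_vol_halfspace:
  fixes A :: "'a::euclidean_space set"
  assumes A: "A \<in> lmeasurable" and "bounded A" and "u \<noteq> 0" and "0 \<le> y" "y \<le> vol A"
  obtains s where "vol (A \<inter> {x. u \<bullet> x \<le> s}) = y"
proof -
  obtain B where B: "\<And>x. x \<in> A \<Longrightarrow> norm x \<le> B" "B > 0"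
    using \<open>bounded A\<close> by (meson bounded_pos)
  let ?c = "norm u * B"
  have c: "\<bar>u \<bullet> x\<bar> \<le> ?c" if "x \<in> A" for x
    using Cauchy_Schwarz_ineq2[of u x] B(1)[OF that]
    by (smt (verit, best) mult_left_mono norm_ge_zero)
  \<comment> \<open>By Cauchy-Schwarz \<open>A\<close> lies between the levels \<open>- ?c\<close>
    and \<open>?c\<close>. The halfspaces are closed, so the lower level is lowered by 1 to miss
    \<open>A\<close> altogether.\<close>
  have "A \<inter> {x. u \<bullet> x \<le> - ?c - 1} = {}" "A \<inter> {x. u \<bullet> x \<le> ?c} = A"
    using c by force+
  then have "vol (A \<inter> {x. u \<bullet> x \<le> - ?c - 1}) \<le> y" "y \<le> vol (A \<inter> {x. u \<bullet> x \<le> ?c})"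
    using assms by auto
  moreover have "- ?c - 1 \<le> ?c"
    using mult_nonneg_nonneg[of "norm u" B] B(2) norm_ge_zero[of u] by linarith
  ultimately obtain s where "vol (A \<inter> {x. u \<bullet> x \<le> s}) = y"
    using IVT'[of "\<lambda>s. vol (A \<inter> {x. u \<bullet> x \<le> s})" "- ?c - 1" y ?c] 
      continuous_on_vol_halfspace[OF A \<open>u \<noteq> 0\<close>] by blast
  then show thesis by (rule that)
qed

section \<open>The Brunn--Minkowski inequality\<close>

lemma open_set_plus:
  fixes A B :: "'a::real_normed_vector set"
  assumes "open A"
  shows "open (A + B)"
proof -
  have "A + B = (\<Union>x\<in>A. \<Union>y\<in>B. {x + y})"
    by (auto simp: set_plus_def)
  then show ?thesis
    using open_sums[of A B] assms by simp
qed

lemma compact_set_plus: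
  fixes A B :: "'a::real_normed_vector set"
  assumes "compact A" "compact B"
  shows "compact (A + B)"
  using compact_sums[OF assms] by (simp add: set_plus_def Bex_def Collect_ex_eq conj_ac) 

lemma bounded_set_plus:
  fixes A B :: "'a::real_normed_vector set"
  assumes "bounded A" "bounded B"
  shows "bounded (A + B)"
proof -
  have "A + B = (\<lambda>p. fst p + snd p) ` (A \<times> B)"
    by (force simp: set_plus_def)
  then show ?thesis
    using bounded_plus[OF assms] by (simp add: case_prod_beta')
qed

text \<open>The inequality is kept in its power form because the volumes of disjoint pieces add up,
  while their roots do not.\<close>

definition brunn_minkowski :: "'a::euclidean_space set \<Rightarrow> 'a set \<Rightarrow> bool" where
  "brunn_minkowski A B \<longleftrightarrow>
    (root DIM('a) (vol A) + root DIM('a) (vol B)) ^ DIM('a) \<le> vol (A + B)"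

lemma brunn_minkowski_commute: "brunn_minkowski A B \<longleftrightarrow> brunn_minkowski B A"
  by (simp add: brunn_minkowski_def add.commute)

text \<open>The bound is homogeneous in the pair of volumes. Pieces taking the same fraction
  \<open>t\<close> of both sets therefore contribute exactly \<open>t\<close> times the full bound,
  the complementary pieces \<open>1 - t\<close> times, and disjointness of the two sums lets these
  contributions add.\<close>

lemma brunn_minkowski_split:
  fixes A B :: "'a::euclidean_space set"
  assumes AB: "A + B \<in> lmeasurable"
    and meas: "A1 + B1 \<in> lmeasurable" "A2 + B2 \<in> lmeasurable"
    and sub: "A1 \<subseteq> A" "A2 \<subseteq> A" "B1 \<subseteq> B" "B2 \<subseteq> B"
    and disj: "(A1 + B1) \<inter> (A2 + B2) = {}"
    and t: "0 \<le> t" "t \<le> 1"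
    and A12: "vol A1 = t * vol A" "vol A2 = (1 - t) * vol A"
    and B12: "vol B1 = t * vol B" "vol B2 = (1 - t) * vol B"
    and bm: "brunn_minkowski A1 B1" "brunn_minkowski A2 B2"
  shows "brunn_minkowski A B"
proof -
  let ?N = "DIM('a)"
  let ?r = "root ?N (vol A) + root ?N (vol B)"
  have *: "s * ?r ^ ?N \<le> vol (C + D)"
    if "vol C = s * vol A" "vol D = s * vol B" "brunn_minkowski C D" "0 \<le> s"
    for s and C D :: "'a set"
  proof -
    have "(root ?N (vol C) + root ?N (vol D)) ^ ?N = (root ?N s * ?r) ^ ?N"
      by (simp add: that real_root_mult distrib_left)
    also have "\<dots> = s * ?r ^ ?N"
      using that by (simp add: power_mult_distrib)
    finally show ?thesis
      using that by (simp add: brunn_minkowski_def)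
  qed
  have "?r ^ ?N = t * ?r ^ ?N + (1 - t) * ?r ^ ?N"
    by (simp add: algebra_simps)
  also have "\<dots> \<le> vol (A1 + B1) + vol (A2 + B2)"
    using t A12 B12 bm by (intro add_mono *) auto
  also have "\<dots> = vol ((A1 + B1) \<union> (A2 + B2))"
    using meas disj by (simp add: measure_Un3)
  also have "\<dots> \<le> vol (A + B)"
    using sub meas AB by (intro measure_mono_fmeasurable Un_least set_plus_mono2) (auto intro: fmeasurableD)
  finally show ?thesis
    by (simp add: brunn_minkowski_def)
qed

section \<open>The inequality for two boxes\<close>

lemma vol_box:
  fixes a b :: "'a::euclidean_space"
  assumes "box a b \<noteq> {}"
  shows "vol (box a b) = (\<Prod>i\<in>Basis. b \<bullet> i - a \<bullet> i)"
  using assms by (auto simp: box_ne_empty inner_diff_left less_imp_le)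

text \<open>The sum contains a box whose side lengths are \<open>p i + q i\<close>. After division
  by the root of its volume, both terms on the left are geometric means, of the ratios
  \<open>p i / (p i + q i)\<close> and \<open>q i / (p i + q i)\<close>. Their arithmetic means add
  up to 1.\<close>

lemma brunn_minkowski_box:
  fixes a b c d :: "'a::euclidean_space"
  assumes ne: "box a b \<noteq> {}" "box c d \<noteq> {}"
  shows "brunn_minkowski (box a b) (box c d)"
proof -
  let ?N = "DIM('a)"
  define p q where "p i = b \<bullet> i - a \<bullet> i" and "q i = d \<bullet> i - c \<bullet> i" for i
  have pos: "p i > 0" "q i > 0" if "i \<in> Basis" for i
    using ne that by (auto simp: p_def q_def box_ne_empty)
  have sub: "box (a + c) (b + d) \<subseteq> box a b + box c d"
  proof
    fix x assume x: "x \<in> box (a + c) (b + d)"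
    \<comment> \<open>\<open>s i\<close> is the relative position of \<open>x\<close> along side
      \<open>i\<close> of the large box. The summands \<open>y\<close> and \<open>x - y\<close> are
      the points at the same relative position in the two small boxes.\<close>
    define s where "s i = (x \<bullet> i - (a + c) \<bullet> i) / (p i + q i)" for i
    define y where "y = (\<Sum>i\<in>Basis. (a \<bullet> i + s i * p i) *\<^sub>R i)"
    have s: "0 < s i \<and> s i < 1" if "i \<in> Basis" for i
      using x pos[OF that] that by (auto simp: s_def mem_box divide_simps p_def q_def inner_add_left)
    have yi: "y \<bullet> i = a \<bullet> i + s i * p i" if "i \<in> Basis" for i
      using that by (simp add: y_def)
    have xyi: "(x - y) \<bullet> i = c \<bullet> i + s i * q i" if "i \<in> Basis" for i
    proof -
      have "x \<bullet> i = (a + c) \<bullet> i + s i * (p i + q i)"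
        using pos[OF that] by (simp add: s_def)
      then show ?thesis
        using that by (simp add: inner_diff_left yi inner_add_left algebra_simps)
    qed
    have lin: "l < l + r * h \<and> l + r * h < m" if "0 < r" "r < 1" "h = m - l" "h > 0" for l r h m :: real
    proof -
      have "0 < r * h" "r * h < 1 * h"
        using that(1,2,4) by (simp, intro mult_strict_right_mono)
      then show ?thesis
        using that(3) by linarith
    qed
    have "y \<in> box a b"
      using lin[OF _ _ p_def pos(1)] s by (simp add: mem_box yi)
    moreover have "x - y \<in> box c d"
      using lin[OF _ _ q_def pos(2)] s by (simp add: mem_box xyi)
    ultimately show "x \<in> box a b + box c d"
      using set_plus_intro by fastforce
  qed
  have nz: "(\<Prod>i\<in>Basis. p i + q i) > 0"
    using pos by (intro prod_pos) (auto intro: add_pos_pos)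
  define R where "R = root ?N (\<Prod>i\<in>Basis. p i + q i)"
  have R: "R > 0" "R ^ ?N = (\<Prod>i\<in>Basis. p i + q i)"
    using nz by (simp_all add: R_def real_root_gt_zero)
  have amgm: "root ?N (\<Prod>i\<in>Basis. f i) / R \<le> (\<Sum>i\<in>Basis. f i / (p i + q i)) / ?N"
    if "\<And>i. i \<in> (Basis::'a set) \<Longrightarrow> f i > 0" for f
  proof -
    have "root ?N (\<Prod>i\<in>Basis. f i) / R = root ?N (\<Prod>i\<in>(Basis::'a set). f i / (p i + q i))"
      by (simp add: R_def real_root_divide prod_dividef)
    also have "\<dots> = (\<Prod>i\<in>Basis. f i / (p i + q i)) powr (1 / ?N)"
      using that pos by (intro root_powr_inverse prod_nonneg ballI) (auto intro!: less_imp_le[OF divide_pos_pos] add_pos_pos)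
    also have "\<dots> \<le> (\<Sum>i\<in>Basis. f i / (p i + q i) / ?N)"
      using that pos by (intro arith_geom_mean) (auto intro!: less_imp_le[OF divide_pos_pos] add_pos_pos)
    finally show ?thesis
      by (simp add: sum_divide_distrib)
  qed
  have "(root ?N (\<Prod>i\<in>Basis. p i) + root ?N (\<Prod>i\<in>Basis. q i)) / R
      \<le> (\<Sum>i\<in>Basis. p i / (p i + q i)) / ?N + (\<Sum>i\<in>Basis. q i / (p i + q i)) / ?N"
    unfolding add_divide_distrib using pos by (intro add_mono amgm)
  also have "\<dots> = (\<Sum>i\<in>(Basis::'a set). 1) / ?N"
    unfolding add_divide_distrib[symmetric] sum.distrib[symmetric]
    using pos by (intro arg_cong2[of _ _ _ _ "(/)"] sum.cong) (auto, smt (verit) divide_self)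
  finally have "root ?N (\<Prod>i\<in>Basis. p i) + root ?N (\<Prod>i\<in>Basis. q i) \<le> R"
    using R(1) by (simp add: pos_divide_le_eq)
  moreover have "0 \<le> root ?N (\<Prod>i\<in>Basis. p i) + root ?N (\<Prod>i\<in>Basis. q i)"
    using pos by (intro add_nonneg_nonneg real_root_ge_zero prod_nonneg) (auto intro: less_imp_le)
  ultimately have "(root ?N (\<Prod>i\<in>Basis. p i) + root ?N (\<Prod>i\<in>Basis. q i)) ^ ?N \<le> R ^ ?N"
    by (intro power_mono)
  also have "\<dots> = vol (box (a + c) (b + d))"
    unfolding R using pos
    by (subst vol_box) (auto simp: box_ne_empty p_def q_def inner_add_left algebra_simps intro: add_strict_mono)
  also have "\<dots> \<le> vol (box a b + box c d)"
    using sub by (intro measure_mono_fmeasurable lmeasurable_open bounded_set_plus open_set_plus) auto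
  finally show ?thesis
    by (simp add: brunn_minkowski_def vol_box[OF ne(1)] vol_box[OF ne(2)] p_def q_def)
qed

section \<open>Finite unions of disjoint open boxes\<close>

definition box_family :: "'a::euclidean_space set set \<Rightarrow> bool" where
  "box_family D \<longleftrightarrow> finite D \<and> disjoint D \<and> (\<forall>Q\<in>D. Q \<noteq> {} \<and> (\<exists>a b. Q = box a b))"

lemma box_family_Union:
  assumes "box_family D"
  shows "open (\<Union>D)" "bounded (\<Union>D)" "\<Union>D \<in> lmeasurable"
proof -
  show "open (\<Union>D)"
    using assms unfolding box_family_def by (metis open_Union open_box)
  moreover show "bounded (\<Union>D)"
    using assms unfolding box_family_def by (metis bounded_Union bounded_box)
  ultimately show "\<Union>D \<in> lmeasurable"
    by (rule lmeasurable_open[rotated])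
qed

text \<open>Cuts are made in coordinate directions because these keep boxes boxes: only a bound of
  coordinate \<open>i\<close> is truncated at \<open>s\<close>.\<close>

lemma box_Int_halfspace:
  fixes a b :: "'a::euclidean_space"
  assumes "i \<in> Basis"
  shows "\<exists>c d. box a b \<inter> {x. i \<bullet> x < s} = box c d" "\<exists>c d. box a b \<inter> {x. i \<bullet> x > s} = box c d"
proof -
  have *: "(\<Sum>j\<in>Basis. (if j = i then f j else g j) *\<^sub>R j) \<bullet> k = (if k = i then f k else g k)"
    if "k \<in> Basis" for f g :: "'a \<Rightarrow> real" and k
    using that by simp
  have "box a b \<inter> {x. i \<bullet> x < s} = box a (\<Sum>j\<in>Basis. (if j = i then min (b \<bullet> j) s else b \<bullet> j) *\<^sub>R j)"
    using assms by (auto simp: mem_box * inner_commute[of i] split: if_splits)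
  moreover have "box a b \<inter> {x. i \<bullet> x > s} = box (\<Sum>j\<in>Basis. (if j = i then max (a \<bullet> j) s else a \<bullet> j) *\<^sub>R j) b"
    using assms by (auto simp: mem_box * inner_commute[of i] split: if_splits)
  ultimately show "\<exists>c d. box a b \<inter> {x. i \<bullet> x < s} = box c d" "\<exists>c d. box a b \<inter> {x. i \<bullet> x > s} = box c d"
    by blast+
qed

text \<open>Empty traces are discarded, since the boxes of a \<open>box_family\<close> are nonempty;
  this is what gives every nonempty family positive volume.\<close>

definition cut_family :: "'a set \<Rightarrow> 'a set set \<Rightarrow> 'a set set" where
  "cut_family H D = (\<lambda>Q. Q \<inter> H) ` D - {{}}"

lemma Union_cut_family: "\<Union>(cut_family H D) = \<Union>D \<inter> H"
  by (auto simp: cut_family_def)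

text \<open>A box missed by \<open>H\<close> leaves no trace. The resulting strict decrease drives
  the induction on the number of boxes.\<close>

lemma card_cut_family:
  assumes "finite D"
  shows "card (cut_family H D) \<le> card D"
    and "Q \<in> D \<Longrightarrow> Q \<inter> H = {} \<Longrightarrow> card (cut_family H D) < card D"
proof -
  show "card (cut_family H D) \<le> card D"
  proof -
    have "card (cut_family H D) \<le> card ((\<lambda>Q. Q \<inter> H) ` D)"
      unfolding cut_family_def using assms by (intro card_mono) auto
    also have "\<dots> \<le> card D"
      using assms by (rule card_image_le)
    finally show ?thesis .
  qed
  assume "Q \<in> D" "Q \<inter> H = {}"
  then have "cut_family H D \<subseteq> (\<lambda>Q. Q \<inter> H) ` (D - {Q})"
    by (auto simp: cut_family_def)
  then have "card (cut_family H D) \<le> card (D - {Q})"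
    by (meson assms card_image_le card_mono finite_Diff finite_imageI le_trans)
  also have "\<dots> < card D"
    using \<open>Q \<in> D\<close> assms by (meson card_Diff1_less)
  finally show "card (cut_family H D) < card D" .
qed

lemma box_family_cut:
  assumes "box_family D" "i \<in> Basis"
    and H: "H = {x. i \<bullet> x < s} \<or> H = {x. i \<bullet> x > s}"
  shows "box_family (cut_family H D)"
proof -
  have "\<exists>c d. Q \<inter> H = box c d" if "Q \<in> D" for Q
    using assms that box_Int_halfspace[OF \<open>i \<in> Basis\<close>] unfolding box_family_def by metis
  moreover have "disjoint (cut_family H D)"
    using assms(1) unfolding box_family_def cut_family_def disjoint_def by blast
  ultimately show ?thesis
    using assms(1) by (auto simp: box_family_def cut_family_def)
qed

text \<open>Disjoint nonempty boxes have disjoint side intervals in some coordinate. As the boxes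
  are open, the upper end of the lower interval separates them with strict inequalities on both
  sides.\<close>

lemma box_family_separation:
  fixes D :: "'a::euclidean_space set set"
  assumes D: "box_family D" and card: "card D \<ge> 2"
  obtains Q Q' s and i :: 'a where "Q \<in> D" "Q' \<in> D" "i \<in> Basis" "Q \<subseteq> {x. i \<bullet> x < s}" "Q' \<subseteq> {x. i \<bullet> x > s}"
proof -
  obtain Q Q' where Q: "Q \<in> D" "Q' \<in> D" "Q \<noteq> Q'"
    using card by (metis One_nat_def Suc_1 card_le_Suc0_iff_eq D box_family_def not_less_eq_eq)
  obtain a b where a: "Q = box a b"
    using D Q(1) by (metis box_family_def)
  obtain c d where c: "Q' = box c d"
    using D Q(2) by (metis box_family_def)
  note ab = a c
  have "box a b \<noteq> {}" "box c d \<noteq> {}" "box a b \<inter> box c d = {}"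
    using D Q ab by (auto simp: box_family_def disjoint_def)
  then obtain i where i: "i \<in> Basis" "b \<bullet> i \<le> c \<bullet> i \<or> d \<bullet> i \<le> a \<bullet> i"
    by (auto simp: disjoint_interval box_ne_empty not_le)
  have sub: "box p q \<subseteq> {x. i \<bullet> x < q \<bullet> i}" "q \<bullet> i \<le> t \<bullet> i \<Longrightarrow> box t r \<subseteq> {x. i \<bullet> x > q \<bullet> i}" for p q t r
    using i(1) by (auto simp: mem_box inner_commute intro: le_less_trans)
  from i(2) show thesis
  proof
    assume "b \<bullet> i \<le> c \<bullet> i"
    then show thesis
      using that[of Q Q' i "b \<bullet> i"] Q i(1) sub ab by blast
  next
    assume "d \<bullet> i \<le> a \<bullet> i"
    then show thesis
      using that[of Q' Q i "d \<bullet> i"] Q i(1) sub ab by blast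
  qed
qed

text \<open>Each half of the first family loses one of the two separated boxes, and no cut enlarges
  the second family. The total number of boxes thus falls on both sides of the cut.\<close>

lemma brunn_minkowski_box_family:
  fixes D E :: "'a::euclidean_space set set"
  assumes "box_family D" "box_family E" "D \<noteq> {}" "E \<noteq> {}"
  shows "brunn_minkowski (\<Union>D) (\<Union>E)"
  using assms
proof (induction "card D + card E" arbitrary: D E rule: less_induct)
  case less
  \<comment> \<open>\<open>F\<close> is whichever family has at least two boxes, and the induction
    hypothesis is passed as an assumption. The same argument then serves for \<open>D\<close> and
    \<open>E\<close> in either order.\<close>
  have step: "brunn_minkowski (\<Union>F) (\<Union>G)"
    if F: "box_family F" "F \<noteq> {}" "card F \<ge> 2" and G: "box_family G" "G \<noteq> {}"
      and IH: "\<And>F' G' :: 'a set set. card F' + card G' < card F + card G \<Longrightarrow> box_family F' \<Longrightarrow> box_family G' \<Longrightarrow>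
          F' \<noteq> {} \<Longrightarrow> G' \<noteq> {} \<Longrightarrow> brunn_minkowski (\<Union>F') (\<Union>G')"
    for F G :: "'a set set"
  proof -
    obtain Q Q' s i where Q: "Q \<in> F" "Q' \<in> F" "Q \<subseteq> {x. i \<bullet> x < s}" "Q' \<subseteq> {x. i \<bullet> x > s}"
      and i: "i \<in> Basis"
      using box_family_separation[OF F(1,3)] by metis
    have i0: "i \<noteq> 0"
      using i by auto
    note lmF = box_family_Union[OF F(1)] and lmG = box_family_Union[OF G(1)]
    let ?A = "\<Union>F" and ?B = "\<Union>G"
    have pos: "vol (\<Union>D) > 0" if "box_family D" "D \<noteq> {}" for D :: "'a set set"
    proof -
      have "\<Union>D \<noteq> {}"
        using that by (auto simp: box_family_def)
      then have "\<not> negligible (\<Union>D)"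
        using box_family_Union[OF that(1)] open_not_negligible by blast
      then show ?thesis
        using box_family_Union[OF that(1)] by (simp add: negligible_iff_measure0 zero_less_measure_iff)
    qed
    define F1 F2 where "F1 = cut_family {x. i \<bullet> x < s} F" and "F2 = cut_family {x. i \<bullet> x > s} F"
    have F12: "box_family F1" "box_family F2"
      using box_family_cut[OF F(1) i] by (auto simp: F1_def F2_def)
    have "Q \<inter> {x. i \<bullet> x < s} \<noteq> {}" "Q' \<inter> {x. i \<bullet> x > s} \<noteq> {}"
      using Q F(1) unfolding box_family_def by blast+
    then have F12_ne: "F1 \<noteq> {}" "F2 \<noteq> {}"
      using Q(1,2) by (auto simp: F1_def F2_def cut_family_def)
    have "Q' \<inter> {x. i \<bullet> x < s} = {}" "Q \<inter> {x. i \<bullet> x > s} = {}"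
      using Q by force+
    then have cF12: "card F1 < card F" "card F2 < card F"
      using F(1) Q(1,2) by (auto simp: F1_def F2_def box_family_def intro: card_cut_family)
    have A: "\<Union>F1 = ?A \<inter> {x. i \<bullet> x < s}" "\<Union>F2 = ?A \<inter> {x. i \<bullet> x > s}"
      by (simp_all add: F1_def F2_def Union_cut_family)
    have volA: "vol (\<Union>F2) = vol ?A - vol (\<Union>F1)"
      unfolding A using vol_halfspace_split[OF lmF(3) i0] by simp
    define t where "t = vol (\<Union>F1) / vol ?A"
    have vA: "vol ?A > 0" and vB: "vol ?B > 0"
      using pos F G by auto
    have vF1: "vol (\<Union>F1) = t * vol ?A"
      using vA by (simp add: t_def)
    with volA have vF2: "vol (\<Union>F2) = (1 - t) * vol ?A"
      by (simp add: algebra_simps)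
    \<comment> \<open>Strictness gives both parts of \<open>G\<close> positive volume, so they are
      nonempty as the induction hypothesis demands.\<close>
    have t: "0 < t" "t < 1"
      using pos[OF F12(1) F12_ne(1)] pos[OF F12(2) F12_ne(2)] vA unfolding vF1 vF2
      by (simp_all add: zero_less_mult_iff)
    have "0 \<le> t * vol ?B" "t * vol ?B \<le> vol ?B"
      using t vB by auto
    then obtain r where r: "vol (?B \<inter> {x. i \<bullet> x \<le> r}) = t * vol ?B"
      using obtain_vol_halfspace[OF lmG(3,2) i0] by blast
    define G1 G2 where "G1 = cut_family {x. i \<bullet> x < r} G" and "G2 = cut_family {x. i \<bullet> x > r} G"
    have G12: "box_family G1" "box_family G2"
      using box_family_cut[OF G(1) i] by (auto simp: G1_def G2_def)
    have cG12: "card G1 \<le> card G" "card G2 \<le> card G"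
      using G(1) by (auto simp: G1_def G2_def box_family_def intro: card_cut_family)
    have B: "\<Union>G1 = ?B \<inter> {x. i \<bullet> x < r}" "\<Union>G2 = ?B \<inter> {x. i \<bullet> x > r}"
      by (simp_all add: G1_def G2_def Union_cut_family)
    have vG1: "vol (\<Union>G1) = t * vol ?B" and vG2: "vol (\<Union>G2) = (1 - t) * vol ?B"
      unfolding B using vol_halfspace_split[OF lmG(3) i0, of r] r by (simp_all add: algebra_simps)
    have G12_ne: "G1 \<noteq> {}" "G2 \<noteq> {}"
      using vG1 vG2 t vB by auto
    have lm: "\<Union>F' + \<Union>G' \<in> lmeasurable" if "box_family F'" "box_family G'" for F' G' :: "'a set set"
      using that by (intro lmeasurable_open bounded_set_plus open_set_plus box_family_Union)
    show ?thesis
    proof (rule brunn_minkowski_split)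
      \<comment> \<open>The two sums lie strictly on opposite sides of the hyperplane at level
        \<open>s + r\<close>.\<close>
      show "(\<Union>F1 + \<Union>G1) \<inter> (\<Union>F2 + \<Union>G2) = {}"
      proof -
        have "\<Union>F1 + \<Union>G1 \<subseteq> {x. i \<bullet> x < s + r}" "\<Union>F2 + \<Union>G2 \<subseteq> {x. i \<bullet> x > s + r}"
          unfolding A B by (auto simp: set_plus_def inner_add_right intro: add_strict_mono)
        then show ?thesis by force
      qed
      show "brunn_minkowski (\<Union>F1) (\<Union>G1)"
        using add_less_le_mono[OF cF12(1) cG12(1)] F12(1) G12(1) F12_ne(1) G12_ne(1) by (rule IH)
      show "brunn_minkowski (\<Union>F2) (\<Union>G2)"
        using add_less_le_mono[OF cF12(2) cG12(2)] F12(2) G12(2) F12_ne(2) G12_ne(2) by (rule IH)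
      show "\<Union>F1 \<subseteq> ?A" "\<Union>F2 \<subseteq> ?A" "\<Union>G1 \<subseteq> ?B" "\<Union>G2 \<subseteq> ?B"
        unfolding A B by (rule Int_lower1)+
      show "0 \<le> t" "t \<le> 1"
        using t by simp_all
    qed (fact vF1 vF2 vG1 vG2 | intro lm F12 G12 F(1) G(1))+
  qed
  consider "card D \<ge> 2" | "card E \<ge> 2" | "card D = 1" "card E = 1"
  proof -
    have "card D \<noteq> 0" "card E \<noteq> 0"
      using less.prems by (auto simp: box_family_def)
    then show thesis
      using that by linarith
  qed
  then show ?case
  proof cases
    case 1
    then show ?thesis
      by (rule step[OF less.prems(1,3) _ less.prems(2,4) less.hyps])
  next
    case 2
    have "brunn_minkowski (\<Union>E) (\<Union>D)"
      by (rule step[OF less.prems(2,4) 2 less.prems(1,3)], rule less.hyps) (simp_all add: add.commute)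
    then show ?thesis
      by (simp add: brunn_minkowski_commute)
  next
    case 3
    then obtain P Q where "D = {P}" "E = {Q}"
      by (auto simp: card_1_singleton_iff)
    then show ?thesis
      using less.prems(1,2) by (auto simp: box_family_def intro: brunn_minkowski_box)
  qed
qed

section \<open>From box families to convex bodies\<close>

lemma box_family_approximation:
  fixes S :: "'a::euclidean_space set"
  assumes "open S" "bounded S" and y: "0 \<le> y" "y < vol S"
  obtains D where "box_family D" "D \<noteq> {}" "\<Union>D \<subseteq> S" "y < vol (\<Union>D)"
proof -
  obtain a b where ab: "S \<subseteq> box a b"
    using bounded_subset_box_symmetric[OF \<open>bounded S\<close>] by metis
  have "S \<noteq> {}"
    using y by auto
  \<comment> \<open>The covering lemma places each closed box inside \<open>g x\<close> for some
    \<open>x\<close> in \<open>S\<close>, hence inside \<open>S\<close>. Outside \<open>S\<close>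
    the value \<open>UNIV\<close> merely makes \<open>g\<close> a gauge. The boxes then cover
    exactly \<open>S\<close>.\<close>
  define g where "g x = (if x \<in> S then S else UNIV)" for x
  have "S \<subseteq> cbox a b" "box a b \<noteq> {}"
    using ab \<open>S \<noteq> {}\<close> box_subset_cbox by blast+
  moreover have "gauge g"
    using \<open>open S\<close> by (auto simp: gauge_def g_def)
  ultimately obtain C where C: "countable C" "\<And>K. K \<in> C \<Longrightarrow> interior K \<noteq> {} \<and> (\<exists>c d. K = cbox c d)"
    "pairwise (\<lambda>A B. interior A \<inter> interior B = {}) C"
    "\<And>K. K \<in> C \<Longrightarrow> \<exists>x \<in> S \<inter> K. K \<subseteq> g x" "S \<subseteq> \<Union>C"
    by (rule covering_lemma) (rule that; assumption)
  have lm: "K \<in> lmeasurable" if "K \<in> C" for K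
    using C(2)[OF that] by auto
  have "\<Union>C = S"
  proof
    show "\<Union>C \<subseteq> S"
    proof
      fix z assume "z \<in> \<Union>C"
      then obtain K where K: "K \<in> C" "z \<in> K" by blast
      then obtain x where "x \<in> S" "K \<subseteq> g x"
        using C(4)[OF K(1)] by blast
      with K(2) show "z \<in> S"
        by (auto simp: g_def)
    qed
  qed (rule C(5))
  then have "\<not> vol (\<Union>C) \<le> y"
    using y by simp
  \<comment> \<open>If every finite subunion had volume at most \<open>y\<close>, so would the
    countable union.\<close>
  then obtain F where F: "F \<subseteq> C" "finite F" "y < vol (\<Union>F)"
    using measure_Union_bound[OF C(1) lm, of y] not_le by metis
  have FC: "\<exists>c d. Q = cbox c d \<and> box c d \<noteq> {} \<and> interior Q = box c d" if "Q \<in> F" for Q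
  proof -
    obtain c d where "Q = cbox c d"
      using \<open>Q \<in> F\<close> F(1) C(2)[of Q] by blast
    then show ?thesis
      using that F(1) C(2)[of Q] by auto
  qed
  let ?D = "interior ` F"
  have "disjoint ?D"
  proof (rule disjointI)
    fix P P' assume "P \<in> ?D" "P' \<in> ?D" and ne: "P \<noteq> P'"
    then obtain Q Q' where "Q \<in> F" "Q' \<in> F" and P: "P = interior Q" "P' = interior Q'"
      by blast
    with ne F(1) have "Q \<in> C" "Q' \<in> C" "Q \<noteq> Q'"
      by auto
    then show "P \<inter> P' = {}"
      unfolding P using C(3) by (simp add: pairwise_def)
  qed
  then have D: "box_family ?D"
    unfolding box_family_def
  proof (intro conjI ballI)
    show "finite ?D"
      using F(2) by simp
    fix P assume "P \<in> ?D"
    then obtain Q where "Q \<in> F" "P = interior Q" by blast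
    then show "P \<noteq> {}" "\<exists>a b. P = box a b"
      using FC[of Q] by metis+
  qed
  \<comment> \<open>Passing to interiors makes the boxes open and truly disjoint, at the cost of
    their null boundaries.\<close>
  have "negligible (\<Union>Q\<in>F. Q - interior Q)"
  proof (intro negligible_Union ballI finite_imageI F(2), safe)
    fix Q assume "Q \<in> F"
    then show "negligible (Q - interior Q)"
      using FC[of Q] negligible_frontier_interval by metis
  qed
  then have "negligible (\<Union>?D - \<Union>F \<union> (\<Union>F - \<Union>?D))"
    by (rule negligible_subset) (use interior_subset in blast)
  then have "vol (\<Union>?D) = vol (\<Union>F)"
    by (rule measure_negligible_symdiff[OF box_family_Union(3)[OF D], symmetric])
  moreover have "\<Union>?D \<subseteq> S"
    using F(1) \<open>\<Union>C = S\<close> interior_subset by blast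
  ultimately show thesis
    using that[OF D] F(3) y by (metis Union_empty less_le_not_le measure_empty)
qed

text \<open>A failure would be strict and hence survive approximation. Inside \<open>A\<close> and
  \<open>B\<close> there are box families whose volumes have roots exceeding \<open>c\<close> times
  those of the bodies. By the choice of \<open>c\<close>, their sum would have larger volume than
  the set \<open>A + B\<close> containing it.\<close>

theorem brunn_minkowski_convex:
  fixes A B :: "'a::euclidean_space set"
  assumes A: "compact A" "convex A" "vol A > 0"
    and B: "compact B" "convex B" "vol B > 0"
  shows "brunn_minkowski A B"
proof (rule ccontr)
  let ?N = "DIM('a)"
  assume "\<not> brunn_minkowski A B"
  then have lt: "vol (A + B) < (root ?N (vol A) + root ?N (vol B)) ^ ?N"
    by (simp add: brunn_minkowski_def)
  have pos: "root ?N (vol A) > 0" "root ?N (vol B) > 0"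
    using A B by (auto simp: real_root_gt_zero)
  define c where "c = root ?N (vol (A + B)) / (root ?N (vol A) + root ?N (vol B))"
  have c0: "0 \<le> c"
    using pos by (simp add: c_def)
  have "root ?N (vol (A + B)) < root ?N ((root ?N (vol A) + root ?N (vol B)) ^ ?N)"
    using lt by (intro real_root_less_mono) auto
  also have "\<dots> = root ?N (vol A) + root ?N (vol B)"
    using pos by (intro real_root_power_cancel) auto
  finally have c1: "c < 1"
    using add_pos_pos[OF pos] by (simp add: c_def)
  have cN: "0 \<le> c ^ ?N" "c ^ ?N < 1"
    using c0 c1 by (auto simp: power_less_one_iff)
  \<comment> \<open>Open boxes are found inside the interior; the frontier of a convex set is null,
    so no volume is lost.\<close>
  have vol_int: "vol (interior S) = vol S" if "compact S" "convex S" for S :: "'a set"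
    using that by (intro measure_interior) (auto simp: compact_imp_bounded negligible_convex_frontier)
  have approx: "\<exists>D. box_family D \<and> D \<noteq> {} \<and> \<Union>D \<subseteq> S \<and> c * root ?N (vol S) < root ?N (vol (\<Union>D))"
    if S: "compact S" "convex S" "vol S > 0" for S :: "'a set"
  proof -
    have "c ^ ?N * vol S < vol (interior S)"
      using vol_int[OF S(1,2)] S(3) cN by simp
    moreover have "0 \<le> c ^ ?N * vol S"
      using S cN by simp
    ultimately obtain D where D: "box_family D" "D \<noteq> {}" "\<Union>D \<subseteq> interior S" "c ^ ?N * vol S < vol (\<Union>D)"
      using box_family_approximation[of "interior S"] S(1) compact_imp_bounded bounded_interior
      by (metis open_interior)
    have "root ?N (c ^ ?N * vol S) < root ?N (vol (\<Union>D))"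
      using D(4) by (intro real_root_less_mono) auto
    then have "c * root ?N (vol S) < root ?N (vol (\<Union>D))"
      using c0 by (simp add: real_root_mult real_root_power_cancel)
    with D show ?thesis
      using interior_subset by (metis subset_trans)
  qed
  obtain D where D: "box_family D" "D \<noteq> {}" "\<Union>D \<subseteq> A" "c * root ?N (vol A) < root ?N (vol (\<Union>D))"
    using approx[OF A] by blast
  obtain E where E: "box_family E" "E \<noteq> {}" "\<Union>E \<subseteq> B" "c * root ?N (vol B) < root ?N (vol (\<Union>E))"
    using approx[OF B] by blast
  have "root ?N (vol (A + B)) = c * root ?N (vol A) + c * root ?N (vol B)"
    unfolding distrib_left[symmetric] using add_pos_pos[OF pos] by (simp add: c_def)
  also have "\<dots> < root ?N (vol (\<Union>D)) + root ?N (vol (\<Union>E))"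
    using D(4) E(4) by (rule add_strict_mono)
  finally have "root ?N (vol (A + B)) ^ ?N < (root ?N (vol (\<Union>D)) + root ?N (vol (\<Union>E))) ^ ?N"
    by (rule power_strict_mono) auto
  also have "\<dots> \<le> vol (\<Union>D + \<Union>E)"
    using brunn_minkowski_box_family[OF D(1) E(1) D(2) E(2)] by (simp add: brunn_minkowski_def)
  also have "\<dots> \<le> vol (A + B)"
    using D E A B
    by (intro measure_mono_fmeasurable set_plus_mono2 lmeasurable_compact compact_set_plus)
      (auto intro!: borel_open open_set_plus box_family_Union)
  finally show False
    by simp
qed

section \<open>Strict monotonicity of halfspace volumes\<close>

lemma lmeasurable_Int_halfspace:
  fixes A :: "'a::euclidean_space set"
  assumes "A \<in> lmeasurable"
  shows "A \<inter> {x. u \<bullet> x \<le> s} \<in> lmeasurable" "A \<inter> {x. u \<bullet> x \<ge> s} \<in> lmeasurable"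
  using assms by (auto intro!: fmeasurable_Int_fmeasurable borel_closed closed_halfspace_le closed_halfspace_ge)

lemma vol_halfspace_mono:
  fixes A :: "'a::euclidean_space set"
  assumes "A \<in> lmeasurable" "s \<le> t"
  shows "vol (A \<inter> {x. u \<bullet> x \<le> s}) \<le> vol (A \<inter> {x. u \<bullet> x \<le> t})"
  using assms by (intro measure_mono_fmeasurable lmeasurable_Int_halfspace fmeasurableD) auto

text \<open>A convex set with interior points lies in the closure of its interior, so an open set
  meeting \<open>A\<close> also meets the interior of \<open>A\<close>.\<close>

lemma vol_Int_open_pos:
  fixes A :: "'a::euclidean_space set"
  assumes "convex A" "interior A \<noteq> {}" "A \<in> lmeasurable" "open U" "A \<inter> U \<noteq> {}"
  shows "0 < vol (A \<inter> U)"
proof -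
  have "A \<subseteq> closure (interior A)"
    using assms convex_closure_interior closure_subset by metis
  then have "interior A \<inter> U \<noteq> {}"
    using assms open_Int_closure_eq_empty[OF \<open>open U\<close>, of "interior A"] by blast
  then have "\<not> negligible (interior A \<inter> U)"
    by (intro open_not_negligible open_Int \<open>open U\<close>) auto
  then have "\<not> negligible (A \<inter> U)"
    using interior_subset negligible_subset by (metis Int_mono order_refl)
  moreover have "A \<inter> U \<in> lmeasurable"
    using assms by (intro fmeasurable_Int_fmeasurable) auto
  ultimately show ?thesis
    by (simp add: negligible_iff_measure0 zero_less_measure_iff)
qed

text \<open>By connectedness \<open>A\<close> has a point halfway between the two levels, so the
  open slab between them cuts out positive volume.\<close>

lemma vol_halfspace_strict:
  fixes A :: "'a::euclidean_space set"
  assumes A: "convex A" "interior A \<noteq> {}" "A \<in> lmeasurable" and "s < t"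
    and ne: "A \<inter> {x. u \<bullet> x \<le> s} \<noteq> {}" "A \<inter> {x. u \<bullet> x \<ge> t} \<noteq> {}"
  shows "vol (A \<inter> {x. u \<bullet> x \<le> s}) < vol (A \<inter> {x. u \<bullet> x \<le> t})"
proof -
  let ?U = "{x. u \<bullet> x < t} \<inter> {x. u \<bullet> x > s}"
  obtain x y where "x \<in> A" "y \<in> A" "u \<bullet> x \<le> s" "t \<le> u \<bullet> y"
    using ne by blast
  then obtain z where "z \<in> A" "u \<bullet> z = (s + t) / 2"
    using connected_ivt_hyperplane[OF convex_connected[OF A(1)], of x y u "(s + t) / 2"] \<open>s < t\<close> by auto
  then have "A \<inter> ?U \<noteq> {}"
    using \<open>s < t\<close> by force
  moreover have "open ?U"
    by (intro open_Int open_halfspace_lt open_halfspace_gt)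
  ultimately have "0 < vol (A \<inter> ?U)"
    using A by (intro vol_Int_open_pos)
  moreover have "A \<inter> ?U \<in> lmeasurable"
    using A \<open>open ?U\<close> by (intro fmeasurable_Int_fmeasurable) auto
  moreover have "(A \<inter> {x. u \<bullet> x \<le> s}) \<inter> (A \<inter> ?U) = {}"
    by auto
  ultimately have "vol (A \<inter> {x. u \<bullet> x \<le> s}) < vol ((A \<inter> {x. u \<bullet> x \<le> s}) \<union> (A \<inter> ?U))"
    using lmeasurable_Int_halfspace[OF A(3)] by (simp add: measure_Un3)
  also have "\<dots> \<le> vol (A \<inter> {x. u \<bullet> x \<le> t})"
    using \<open>A \<inter> ?U \<in> lmeasurable\<close> lmeasurable_Int_halfspace[OF A(3)] \<open>s < t\<close>
    by (intro measure_mono_fmeasurable fmeasurableD fmeasurable.Un) auto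
  finally show ?thesis .
qed

section \<open>The equality case\<close>

definition unit_body :: "'a::euclidean_space set \<Rightarrow> bool" where
  "unit_body A \<longleftrightarrow> compact A \<and> convex A \<and> vol A = 1"

lemma unit_bodyD:
  assumes "unit_body A"
  shows "compact A" "convex A" "vol A = 1" "A \<in> lmeasurable" "interior A \<noteq> {}" "bounded A"
proof -
  show *: "compact A" "convex A" "vol A = 1"
    using assms by (auto simp: unit_body_def)
  show "A \<in> lmeasurable" "bounded A"
    using * by (auto intro: lmeasurable_compact compact_imp_bounded)
  show "interior A \<noteq> {}"
    using * by (auto simp: negligible_convex_interior[symmetric] dest: negligible_imp_measure0)
qed

text \<open>A volume strictly between 0 and 1 leaves points of \<open>A\<close> on both sides, which
  is what strict monotonicity needs.\<close>

lemma unit_body_halfspace_unique: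
  assumes A: "unit_body A"
    and eq: "vol (A \<inter> {x. u \<bullet> x \<le> s}) = vol (A \<inter> {x. u \<bullet> x \<le> t})"
    and "0 < vol (A \<inter> {x. u \<bullet> x \<le> s})" "vol (A \<inter> {x. u \<bullet> x \<le> s}) < 1"
  shows "s = t"
proof -
  note A' = unit_bodyD[OF A]
  have *: "\<not> s < t" if "0 < vol (A \<inter> {x. u \<bullet> x \<le> s})" "vol (A \<inter> {x. u \<bullet> x \<le> t}) < 1"
    "vol (A \<inter> {x. u \<bullet> x \<le> s}) = vol (A \<inter> {x. u \<bullet> x \<le> t})" for s t
  proof
    assume "s < t"
    have "A \<inter> {x. u \<bullet> x \<le> s} \<noteq> {}"
      using that(1) by auto
    moreover have "A \<inter> {x. u \<bullet> x \<ge> t} \<noteq> {}"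
    proof
      assume "A \<inter> {x. u \<bullet> x \<ge> t} = {}"
      then have "A \<inter> {x. u \<bullet> x \<le> t} = A"
        by fastforce
      then show False
        using that(2) A'(3) by simp
    qed
    ultimately show False
      using vol_halfspace_strict[OF A'(2,5,4) \<open>s < t\<close>] that(3) by fastforce
  qed
  show ?thesis
    using *[of s t] *[of t s] assms by (metis linorder_neqE)
qed

text \<open>The parameter is the root of the cut-off volume, so that the Brunn-Minkowski bound for
  pieces is a power of a linear expression in the parameters. The equivalence records both that the
  level exists and that it is unique.\<close>

lemma unit_body_quantile:
  fixes A :: "'a::euclidean_space set"
  assumes A: "unit_body A" and "u \<noteq> 0"
  obtains q :: "real \<Rightarrow> real" where "continuous_on {0<..<1} q"
    "\<And>t s. 0 < t \<Longrightarrow> t < 1 \<Longrightarrow> vol (A \<inter> {x. u \<bullet> x \<le> s}) = t ^ DIM('a) \<longleftrightarrow> s = q t"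
proof -
  let ?N = "DIM('a)"
  let ?F = "\<lambda>s. vol (A \<inter> {x. u \<bullet> x \<le> s})"
  note A' = unit_bodyD[OF A]
  have tN: "0 < t ^ ?N \<and> t ^ ?N < 1" if "0 < t" "t < 1" for t :: real
    using that by (auto simp: power_less_one_iff)
  have "\<exists>s. ?F s = t ^ ?N" if "0 < t" "t < 1" for t
    using obtain_vol_halfspace[OF A'(4,6) \<open>u \<noteq> 0\<close>, of "t ^ ?N"] tN[OF that] A'(3)
    by (metis less_imp_le)
  then obtain q where q: "?F (q t) = t ^ ?N" if "0 < t" "t < 1" for t
    by metis
  have q_iff: "?F s = t ^ ?N \<longleftrightarrow> s = q t" if t: "0 < t" "t < 1" for s t
    using q[OF t] tN[OF t] unit_body_halfspace_unique[OF A, of u s "q t"] by metis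
  have mono: "q x \<le> q z" if "0 < x" "x \<le> z" "z < 1" for x z
  proof (rule ccontr)
    assume "\<not> q x \<le> q z"
    then have "?F (q z) \<le> ?F (q x)"
      using A'(4) by (intro vol_halfspace_mono) auto
    then have "z ^ ?N \<le> x ^ ?N"
      using q that by simp
    then have "z \<le> x"
      using that by (subst (asm) power_mono_iff) auto
    with that \<open>\<not> q x \<le> q z\<close> show False
      by simp
  qed
  \<comment> \<open>On a compact interval of levels \<open>q\<close> inverts a continuous function
    and is therefore continuous; every point of the open unit interval is interior to such a closed
    subinterval.\<close>
  have cont: "continuous_on {x..z} q" if "0 < x" "x \<le> z" "z < 1" for x z
  proof -
    let ?f = "\<lambda>s. root ?N (?F s)"
    have fq: "?f (q t) = t" if "0 < t" "t < 1" for t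
      using that q by (simp add: real_root_power_cancel)
    have "continuous_on (?f ` {q x..q z}) q"
    proof (rule continuous_on_inv)
      show "continuous_on {q x..q z} ?f"
        by (intro continuous_on_real_root continuous_on_vol_halfspace A' \<open>u \<noteq> 0\<close>)
      show "\<forall>s\<in>{q x..q z}. q (?f s) = s"
      proof
        fix s assume s: "s \<in> {q x..q z}"
        then have "?F (q x) \<le> ?F s" "?F s \<le> ?F (q z)"
          using A'(4) by (auto intro: vol_halfspace_mono)
        moreover have "0 < ?F (q x)" "?F (q z) < 1"
          using tN q that by auto
        ultimately have F: "0 < ?F s" "?F s < 1"
          by linarith+
        have "?f s ^ ?N = ?F s"
          by (simp add: real_root_pow_pos2)
        moreover have "0 < ?f s" "?f s < 1"
          using F by (auto simp: real_root_gt_zero)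
        ultimately show "q (?f s) = s"
          using q_iff[of "?f s" s] by simp
      qed
    qed simp
    moreover have "{x..z} \<subseteq> ?f ` {q x..q z}"
    proof
      fix t assume t: "t \<in> {x..z}"
      then have "q t \<in> {q x..q z}"
        using that by (auto intro: mono)
      moreover have "t = ?f (q t)"
        using fq t that by simp
      ultimately show "t \<in> ?f ` {q x..q z}"
        by blast
    qed
    ultimately show ?thesis
      by (rule continuous_on_subset)
  qed
  have "continuous_on {0<..<1} q"
  proof (rule continuous_at_imp_continuous_on, safe)
    fix t :: real assume t: "t \<in> {0<..<1}"
    then have "t \<in> interior {t / 2..(t + 1) / 2}"
      by (auto simp: interior_atLeastAtMost_real)
    then show "isCont q t"
      using cont[of "t / 2" "(t + 1) / 2"] t by (intro continuous_on_interior) auto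
  qed
  with q_iff show thesis
    using that by blast
qed

text \<open>For differentiable \<open>p\<close> and \<open>q\<close>, moving along the constraint
  would give equal derivatives at each \<open>w\<close>. Instead the inequality is integrated over
  \<open>w\<close> from \<open>x\<close> to \<open>z\<close>: the integral, as a function of the
  displacement \<open>d\<close>, is differentiable and minimal at 0.\<close>

lemma difference_constant_of_diagonal_min:
  fixes p q :: "real \<Rightarrow> real"
  assumes cont: "continuous_on {0<..<1} p" "continuous_on {0<..<1} q" and ab: "a > 0" "b > 0"
    and min: "\<And>w s t. \<lbrakk>w \<in> {0<..<1}; s \<in> {0<..<1}; t \<in> {0<..<1}; a * s + b * t = (a + b) * w\<rbrakk> \<Longrightarrow>
      a * p w + b * q w \<le> a * p s + b * q t"
    and xz: "0 < x" "x < z" "z < 1"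
  shows "p x - q x = p z - q z"
proof -
  define l r where "l = x / 2" and "r = (z + 1) / 2"
  have lr: "0 < l" "l < x" "z < r" "r < 1"
    using xz by (auto simp: l_def r_def)
  have "{l..r} \<subseteq> {0<..<1}"
    using lr by auto
  then obtain P Q where
    P: "\<And>w. w \<in> {l..r} \<Longrightarrow> (P has_vector_derivative p w) (at w within {l..r})" and
    Q: "\<And>w. w \<in> {l..r} \<Longrightarrow> (Q has_vector_derivative q w) (at w within {l..r})"
    using antiderivative_continuous continuous_on_subset cont by metis
  have P': "(P has_real_derivative p w) (at w)" and Q': "(Q has_real_derivative q w) (at w)"
    if "l < w" "w < r" for w
    using that P[of w] Q[of w] 
    by (simp_all add: at_within_Icc_at has_real_derivative_iff_has_vector_derivative)
  \<comment> \<open>Displacements smaller than \<open>e\<close> keep both shifted arguments between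
    \<open>l\<close> and \<open>r\<close>, where the antiderivatives exist.\<close>
  define e where "e = min (x - l) (r - z) / (a + b)"
  have e: "e > 0"
    using lr ab by (auto simp: e_def)
  have near: "l < w + b * d" "w + b * d < r" "l < w - a * d" "w - a * d < r"
    if "\<bar>d\<bar> < e" "x \<le> w" "w \<le> z" for d w
  proof -
    have "\<bar>d\<bar> * (a + b) < min (x - l) (r - z)"
      using that(1) ab by (simp add: e_def pos_less_divide_eq)
    moreover have "\<bar>b * d\<bar> \<le> \<bar>d\<bar> * (a + b)" "\<bar>a * d\<bar> \<le> \<bar>d\<bar> * (a + b)"
      using ab by (simp_all add: abs_mult distrib_left mult.commute)
    ultimately show "l < w + b * d" "w + b * d < r" "l < w - a * d" "w - a * d < r"
      using that by linarith+
  qed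
  \<comment> \<open>The pair \<open>w + b * d\<close>, \<open>w - a * d\<close> satisfies the
    constraint for every \<open>d\<close>. The derivative of \<open>G d\<close> in \<open>w\<close>
    is the excess over the diagonal value, nonnegative by minimality, so
    \<open>G d z - G d x\<close> is the integrated excess.\<close>
  define G where "G d w = a * P (w + b * d) + b * Q (w - a * d) - (a * P w + b * Q w)" for d w
  have "G d x \<le> G d z" if d: "\<bar>d\<bar> < e" for d
  proof (rule DERIV_nonneg_imp_nondecreasing[of x z])
    show "\<exists>y. DERIV (G d) w :> y \<and> 0 \<le> y" if w: "x \<le> w" "w \<le> z" for w
    proof (intro exI conjI)
      note n = near[OF d w]
      have w': "l < w" "w < r"
        using lr w by auto
      have 1: "((\<lambda>w. P (w + b * d)) has_real_derivative p (w + b * d)) (at w)"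
        using DERIV_shift[of P "p (w + b * d)" w "b * d"] P'[OF n(1,2)] by simp
      have 2: "((\<lambda>w. Q (w - a * d)) has_real_derivative q (w - a * d)) (at w)"
        using DERIV_shift[of Q "q (w - a * d)" w "- (a * d)"] Q'[OF n(3,4)] by simp
      show "DERIV (G d) w :> a * p (w + b * d) + b * q (w - a * d) - (a * p w + b * q w)"
        unfolding G_def by (intro DERIV_diff DERIV_add DERIV_cmult 1 2 P' Q' w')
      have "a * p w + b * q w \<le> a * p (w + b * d) + b * q (w - a * d)"
        using n w lr xz by (intro min) (auto simp: algebra_simps)
      then show "0 \<le> a * p (w + b * d) + b * q (w - a * d) - (a * p w + b * q w)"
        by simp
    qed
  qed (use xz in simp)
  \<comment> \<open>\<open>G 0\<close> vanishes identically, so the integrated excess has a local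
    minimum at \<open>d = 0\<close>. Its derivative there must be 0, which is the claim up to the
    factor \<open>a * b\<close>.\<close>
  then have "\<forall>d. \<bar>0 - d\<bar> < e \<longrightarrow> G 0 z - G 0 x \<le> G d z - G d x"
    by (simp add: G_def)
  moreover have "((\<lambda>d. G d w) has_real_derivative a * b * (p w - q w)) (at 0)"
    if "l < w" "w < r" for w
  proof -
    have "((\<lambda>d. P (w + b * d)) has_real_derivative p w * b) (at 0)"
      by (rule DERIV_chain2[of P]) (use P'[OF that] in \<open>auto intro!: derivative_eq_intros\<close>)
    moreover have "((\<lambda>d. Q (w - a * d)) has_real_derivative q w * (- a)) (at 0)"
      by (rule DERIV_chain2[of Q]) (use Q'[OF that] in \<open>auto intro!: derivative_eq_intros\<close>)
    ultimately show ?thesis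
      unfolding G_def by (auto intro!: derivative_eq_intros simp: algebra_simps)
  qed
  then have "((\<lambda>d. G d z - G d x) has_real_derivative a * b * (p z - q z) - a * b * (p x - q x)) (at 0)"
    using lr xz by (intro DERIV_diff) auto
  ultimately have "a * b * (p z - q z) - a * b * (p x - q x) = 0"
    using e by (intro DERIV_local_min[of _ _ 0 e])
  then show ?thesis
    using ab by simp
qed

section \<open>Equality forces a constant shift in each direction\<close>

lemma vol_scaleR: "vol ((\<lambda>x. a *\<^sub>R x) ` S) = \<bar>a\<bar> ^ DIM('a) * vol S" for S :: "'a::euclidean_space set"
  using measure_lebesgue_affine[of a 0 S] by simp

lemma brunn_minkowski_scaled:
  fixes A B :: "'a::euclidean_space set"
  assumes A: "compact A" "convex A" "vol A = x ^ DIM('a)" "x > 0"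
    and B: "compact B" "convex B" "vol B = y ^ DIM('a)" "y > 0"
    and ab: "a > 0" "b > 0"
  shows "(a * x + b * y) ^ DIM('a) \<le> vol ((\<lambda>x. a *\<^sub>R x) ` A + (\<lambda>x. b *\<^sub>R x) ` B)"
proof -
  have "brunn_minkowski ((\<lambda>x. a *\<^sub>R x) ` A) ((\<lambda>x. b *\<^sub>R x) ` B)"
    using assms by (intro brunn_minkowski_convex compact_scaling convex_scaling) (simp_all add: vol_scaleR)
  then show ?thesis
    using assms by (simp add: brunn_minkowski_def vol_scaleR real_root_mult real_root_power_cancel)
qed

text \<open>Below the level \<open>a * ps + b * qt\<close> the sum has volume at least that of the sum of the pieces
  below \<open>ps\<close> and \<open>qt\<close>; above \<open>a * pw + b * qw\<close> it has volume at least that of the sum of the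
  pieces above \<open>pw\<close> and \<open>qw\<close>. A gap between the two levels would contribute additional volume,
  and equality leaves no room for it.\<close>

lemma quantile_diagonal_min:
  fixes A B :: "'a::euclidean_space set"
  assumes A: "unit_body A" and B: "unit_body B" and "u \<noteq> 0" and ab: "a > 0" "b > 0"
    and eq: "vol ((\<lambda>x. a *\<^sub>R x) ` A + (\<lambda>x. b *\<^sub>R x) ` B) \<le> (a + b) ^ DIM('a)"
    and w: "0 < w" "w < 1" and s: "0 < s" and t: "0 < t"
    and st: "a * s + b * t = (a + b) * w"
    and pw: "vol (A \<inter> {x. u \<bullet> x \<le> pw}) = w ^ DIM('a)" and qw: "vol (B \<inter> {x. u \<bullet> x \<le> qw}) = w ^ DIM('a)"
    and ps: "vol (A \<inter> {x. u \<bullet> x \<le> ps}) = s ^ DIM('a)" and qt: "vol (B \<inter> {x. u \<bullet> x \<le> qt}) = t ^ DIM('a)"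
  shows "a * pw + b * qw \<le> a * ps + b * qt"
proof (rule ccontr)
  let ?N = "DIM('a)"
  assume "\<not> ?thesis"
  then have lt: "a * ps + b * qt < a * pw + b * qw" by simp
  note A' = unit_bodyD[OF A] and B' = unit_bodyD[OF B]
  define M where "M = (\<lambda>x. a *\<^sub>R x) ` A + (\<lambda>x. b *\<^sub>R x) ` B"
  have M: "compact M" "convex M"
    unfolding M_def using A' B' by (auto intro: compact_set_plus compact_scaling convex_set_plus convex_scaling)
  have MI: "x \<in> M \<longleftrightarrow> (\<exists>y\<in>A. \<exists>z\<in>B. x = a *\<^sub>R y + b *\<^sub>R z)" for x
    by (auto simp: M_def set_plus_def)
  \<comment> \<open>The parts of both bodies above \<open>pw\<close> and \<open>qw\<close> have
    volume \<open>v ^ ?N\<close>, so the lower and upper bounds add up to exactly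
    \<open>(a + b) ^ ?N\<close>.\<close>
  define v where "v = root ?N (1 - w ^ ?N)"
  have v: "v > 0" "v ^ ?N = 1 - w ^ ?N"
    using w unfolding v_def by (simp_all add: power_less_one_iff power_le_one real_root_pow_pos2)
  have lm: "M \<in> lmeasurable"
    using M by (simp add: lmeasurable_compact)
  have lower: "((a + b) * w) ^ ?N \<le> vol (M \<inter> {x. u \<bullet> x \<le> a * ps + b * qt})"
  proof -
    let ?S = "(\<lambda>x. a *\<^sub>R x) ` (A \<inter> {x. u \<bullet> x \<le> ps}) + (\<lambda>x. b *\<^sub>R x) ` (B \<inter> {x. u \<bullet> x \<le> qt})"
    have cpt: "compact ?S"
      using A' B' by (intro compact_set_plus compact_scaling compact_Int_closed closed_halfspace_le)
    have sub: "?S \<subseteq> M \<inter> {x. u \<bullet> x \<le> a * ps + b * qt}"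
      using ab by (auto simp: M_def set_plus_def inner_add_right intro!: add_mono mult_left_mono)
    have "(a * s + b * t) ^ ?N \<le> vol ?S"
      using A' B' ps qt s t ab
      by (intro brunn_minkowski_scaled compact_Int_closed closed_halfspace_le convex_Int convex_halfspace_le)
    then show ?thesis
      unfolding st[symmetric]
      by (rule order_trans) (rule measure_mono_fmeasurable[OF sub fmeasurableD[OF lmeasurable_compact[OF cpt]]
        lmeasurable_Int_halfspace(1)[OF lm]])
  qed
  have upper: "((a + b) * v) ^ ?N \<le> vol (M \<inter> {x. u \<bullet> x \<ge> a * pw + b * qw})"
  proof -
    let ?S = "(\<lambda>x. a *\<^sub>R x) ` (A \<inter> {x. u \<bullet> x \<ge> pw}) + (\<lambda>x. b *\<^sub>R x) ` (B \<inter> {x. u \<bullet> x \<ge> qw})"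
    have cpt: "compact ?S"
      using A' B' by (intro compact_set_plus compact_scaling compact_Int_closed closed_halfspace_ge)
    have sub: "?S \<subseteq> M \<inter> {x. u \<bullet> x \<ge> a * pw + b * qw}"
      using ab by (auto simp: M_def set_plus_def inner_add_right intro!: add_mono mult_left_mono)
    have "(a * v + b * v) ^ ?N \<le> vol ?S"
      using A' B' v ab vol_halfspace_split(2)[OF A'(4) \<open>u \<noteq> 0\<close>, of pw] vol_halfspace_split(2)[OF B'(4) \<open>u \<noteq> 0\<close>, of qw]
        pw qw
      by (intro brunn_minkowski_scaled compact_Int_closed closed_halfspace_ge convex_Int convex_halfspace_ge) auto
    then show ?thesis
      unfolding distrib_right
      by (rule order_trans) (rule measure_mono_fmeasurable[OF sub fmeasurableD[OF lmeasurable_compact[OF cpt]]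
        lmeasurable_Int_halfspace(2)[OF lm]])
  qed
  have pos: "((a + b) * w) ^ ?N > 0" "((a + b) * v) ^ ?N > 0"
    using ab w v by auto
  have "M \<inter> {x. u \<bullet> x \<le> a * ps + b * qt} \<noteq> {}" "M \<inter> {x. u \<bullet> x \<ge> a * pw + b * qw} \<noteq> {}"
    using pos lower upper by (metis measure_empty not_le)+
  moreover have "interior M \<noteq> {}"
  proof
    assume "interior M = {}"
    then have "negligible M"
      using M by (simp add: negligible_convex_interior)
    then have "vol (M \<inter> {x. u \<bullet> x \<le> a * ps + b * qt}) = 0"
      by (meson Int_lower1 negligible_imp_measure0 negligible_subset)
    then show False
      using lower pos by simp
  qed
  ultimately have "vol (M \<inter> {x. u \<bullet> x \<le> a * ps + b * qt}) < vol (M \<inter> {x. u \<bullet> x \<le> a * pw + b * qw})"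
    using vol_halfspace_strict[OF M(2) _ lm lt] by blast
  then have "((a + b) * w) ^ ?N + ((a + b) * v) ^ ?N < vol M"
    using lower upper vol_halfspace_split(2)[OF lm \<open>u \<noteq> 0\<close>, of "a * pw + b * qw"] by linarith
  moreover have "((a + b) * w) ^ ?N + ((a + b) * v) ^ ?N = (a + b) ^ ?N"
    unfolding power_mult_distrib v distrib_left[symmetric] by simp
  ultimately show False
    using eq by (simp add: M_def)
qed

text \<open>Otherwise some \<open>t ^ n\<close> lies strictly between the two volumes, and such a
  \<open>t\<close> is automatically in the open unit interval. Then \<open>s < p t\<close> and
  \<open>q t < s - d\<close>, contradicting the constant difference.\<close>

lemma halfspace_shift_le:
  fixes A B :: "'a::euclidean_space set"
  assumes A: "unit_body A" and B: "unit_body B"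
    and p: "\<And>t s. 0 < t \<Longrightarrow> t < 1 \<Longrightarrow> vol (A \<inter> {x. u \<bullet> x \<le> s}) = t ^ DIM('a) \<longleftrightarrow> s = p t"
    and q: "\<And>t s. 0 < t \<Longrightarrow> t < 1 \<Longrightarrow> vol (B \<inter> {x. u \<bullet> x \<le> s}) = t ^ DIM('a) \<longleftrightarrow> s = q t"
    and const: "\<And>t. 0 < t \<Longrightarrow> t < 1 \<Longrightarrow> p t - q t = d"
  shows "vol (B \<inter> {x. u \<bullet> x \<le> s - d}) \<le> vol (A \<inter> {x. u \<bullet> x \<le> s})"
proof (rule ccontr)
  let ?N = "DIM('a)"
  note A' = unit_bodyD[OF A] and B' = unit_bodyD[OF B]
  assume "\<not> ?thesis"
  then have lt: "root ?N (vol (A \<inter> {x. u \<bullet> x \<le> s})) < root ?N (vol (B \<inter> {x. u \<bullet> x \<le> s - d}))"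
    by (simp add: real_root_less_mono)
  then obtain t where t: "root ?N (vol (A \<inter> {x. u \<bullet> x \<le> s})) < t" "t < root ?N (vol (B \<inter> {x. u \<bullet> x \<le> s - d}))"
    using dense by blast
  have "vol (B \<inter> {x. u \<bullet> x \<le> s - d}) \<le> vol B"
    using B'(4) by (intro measure_mono_fmeasurable fmeasurableD lmeasurable_Int_halfspace) auto
  then have "root ?N (vol (B \<inter> {x. u \<bullet> x \<le> s - d})) \<le> 1"
    using B'(3) by simp
  moreover have "0 \<le> root ?N (vol (A \<inter> {x. u \<bullet> x \<le> s}))"
    by simp
  ultimately have t01: "0 < t" "t < 1"
    using t by linarith+
  have tA: "vol (A \<inter> {x. u \<bullet> x \<le> s}) < t ^ ?N"
    using power_strict_mono[OF t(1), of ?N] by (simp add: real_root_pow_pos2)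
  have tB: "t ^ ?N < vol (B \<inter> {x. u \<bullet> x \<le> s - d})"
    using power_strict_mono[OF t(2), of ?N] t01 by (simp add: real_root_pow_pos2)
  have "s < p t"
    using tA p[OF t01, of "p t"] vol_halfspace_mono[OF A'(4), of "p t" s u] by (metis linorder_not_le)
  moreover have "q t < s - d"
    using tB q[OF t01, of "q t"] vol_halfspace_mono[OF B'(4), of "s - d" "q t" u] by (metis linorder_not_le)
  ultimately show False
    using const[OF t01] by simp
qed

lemma halfspace_shift:
  fixes A B :: "'a::euclidean_space set"
  assumes A: "unit_body A" and B: "unit_body B" and "u \<noteq> 0" and ab: "a > 0" "b > 0"
    and eq: "vol ((\<lambda>x. a *\<^sub>R x) ` A + (\<lambda>x. b *\<^sub>R x) ` B) \<le> (a + b) ^ DIM('a)"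
  obtains d where "\<And>s. vol (A \<inter> {x. u \<bullet> x \<le> s}) = vol (B \<inter> {x. u \<bullet> x \<le> s - d})"
proof -
  let ?N = "DIM('a)"
  obtain p where p: "continuous_on {0<..<1} p"
    "\<And>t s. 0 < t \<Longrightarrow> t < 1 \<Longrightarrow> vol (A \<inter> {x. u \<bullet> x \<le> s}) = t ^ ?N \<longleftrightarrow> s = p t"
    by (rule unit_body_quantile[OF A \<open>u \<noteq> 0\<close>]) (rule that; assumption)
  obtain q where q: "continuous_on {0<..<1} q"
    "\<And>t s. 0 < t \<Longrightarrow> t < 1 \<Longrightarrow> vol (B \<inter> {x. u \<bullet> x \<le> s}) = t ^ ?N \<longleftrightarrow> s = q t"
    by (rule unit_body_quantile[OF B \<open>u \<noteq> 0\<close>]) (rule that; assumption)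
  have diff: "p x - q x = p z - q z" if "0 < x" "x < z" "z < 1" for x z
  proof (rule difference_constant_of_diagonal_min[OF p(1) q(1) ab])
    fix w s t :: real
    assume "w \<in> {0<..<1}" "s \<in> {0<..<1}" "t \<in> {0<..<1}" "a * s + b * t = (a + b) * w"
    then show "a * p w + b * q w \<le> a * p s + b * q t"
      using p(2) q(2) by (intro quantile_diagonal_min[OF A B \<open>u \<noteq> 0\<close> ab eq]) auto
  qed (use that in auto)
  have const: "p t - q t = p (1/2) - q (1/2)" if "0 < t" "t < 1" for t
  proof (cases t "1/2 :: real" rule: linorder_cases)
    case less
    then show ?thesis
      using diff[of t "1/2"] that by simp
  next
    case greater
    then show ?thesis
      using diff[of "1/2" t] that by simp
  next
    case equal
    then show ?thesis
      by (simp only:)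
  qed
  define d where "d = p (1/2) - q (1/2)"
  have "vol (A \<inter> {x. u \<bullet> x \<le> s}) = vol (B \<inter> {x. u \<bullet> x \<le> s - d})" for s
  proof (rule order_antisym)
    show "vol (B \<inter> {x. u \<bullet> x \<le> s - d}) \<le> vol (A \<inter> {x. u \<bullet> x \<le> s})"
      unfolding d_def by (rule halfspace_shift_le[OF A B p(2) q(2) const])
    have neg: "q t - p t = - d" if "0 < t" "t < 1" for t
      using const[OF that] by (simp add: d_def)
    \<comment> \<open>Exchanging the bodies reverses the sign of the shift and yields the other
      inequality.\<close>
    have "vol (A \<inter> {x. u \<bullet> x \<le> (s - d) - - d}) \<le> vol (B \<inter> {x. u \<bullet> x \<le> s - d})"
      by (rule halfspace_shift_le[OF B A q(2) p(2) neg])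
    then show "vol (A \<inter> {x. u \<bullet> x \<le> s}) \<le> vol (B \<inter> {x. u \<bullet> x \<le> s - d})"
      by simp
  qed
  then show thesis
    by (rule that)
qed

section \<open>Centroids and recovery of the translation\<close>

definition centroid :: "'a::euclidean_space set \<Rightarrow> 'a" where
  "centroid A = (\<integral>x. x \<partial>lebesgue_on A)"

lemma unit_body_integrable:
  fixes A :: "'a::euclidean_space set"
  assumes A: "unit_body A"
  shows "integrable (lebesgue_on A) (\<lambda>x. x)"
proof -
  note A' = unit_bodyD[OF A]
  interpret finite_measure "lebesgue_on A"
    using A'(4) by (rule finite_measure_lebesgue_on)
  obtain c where c: "\<And>x. x \<in> A \<Longrightarrow> norm x \<le> c"
    using A'(6) by (meson bounded_iff)
  have "(\<lambda>x. x) \<in> borel_measurable (lebesgue_on A)"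
    by (intro continuous_imp_measurable_on_sets_lebesgue continuous_intros) (use A'(4) in auto)
  then show ?thesis
    using c by (intro integrable_const_bound[of _ c]) (auto intro!: AE_I2)
qed

text \<open>The projection of \<open>A\<close> has the distribution of that of \<open>B\<close>
  translated by \<open>d\<close>, since their distribution functions agree; comparing means gives
  \<open>d\<close>. At volume 1 the first moment is the centroid. The shift is thus linear in
  \<open>u\<close>, so one translation vector serves all directions.\<close>

lemma halfspace_shift_centroid:
  fixes A B :: "'a::euclidean_space set"
  assumes A: "unit_body A" and B: "unit_body B"
    and shift: "\<And>s. vol (A \<inter> {x. u \<bullet> x \<le> s}) = vol (B \<inter> {x. u \<bullet> x \<le> s - d})"
  shows "d = u \<bullet> (centroid A - centroid B)"
proof -
  note A' = unit_bodyD[OF A] and B' = unit_bodyD[OF B]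
  let ?DA = "distr (lebesgue_on A) borel (\<lambda>x. u \<bullet> x)" and ?DB = "distr (lebesgue_on B) borel (\<lambda>x. u \<bullet> x)"
  let ?DB' = "distr ?DB borel (\<lambda>y. y + d)"
  have meas: "(\<lambda>x. u \<bullet> x) \<in> borel_measurable (lebesgue_on A)" "(\<lambda>x. u \<bullet> x) \<in> borel_measurable (lebesgue_on B)"
    by (intro continuous_imp_measurable_on_sets_lebesgue continuous_intros; use A'(4) B'(4) in auto)+
  have fin: "finite_borel_measure ?DA" "finite_borel_measure ?DB"
    using A'(4) B'(4) by (auto intro: finite_borel_measure_projection)
  then have fin': "finite_borel_measure ?DB'"
    by (simp add: finite_borel_measure_def finite_borel_measure_axioms_def finite_measure.finite_measure_distr)
  have "cdf ?DA s = cdf ?DB' s" for s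
  proof -
    have "cdf ?DB' s = measure ?DB {..s - d}"
      by (simp add: cdf_def measure_distr vimage_def le_diff_eq atMost_def)
    then show ?thesis
      using shift[of s] measure_projection[OF A'(4), of "{..s}" u] measure_projection[OF B'(4), of "{..s - d}" u]
      by (simp add: cdf_def)
  qed
  then have "?DA = ?DB'"
    by (intro cdf_unique'[OF fin(1) fin'] ext)
  then have "(\<integral>y. y \<partial>?DA) = (\<integral>y. y \<partial>?DB')"
    by (rule arg_cong[where f = "\<lambda>M. \<integral>y. y \<partial>M"])
  moreover have "(\<integral>y. y \<partial>?DA) = u \<bullet> centroid A"
  proof -
    have "(\<integral>y. y \<partial>?DA) = (\<integral>x. u \<bullet> x \<partial>lebesgue_on A)"
      using meas(1) by (rule integral_distr) simp
    also have "\<dots> = u \<bullet> centroid A"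
      unfolding centroid_def by (rule integral_inner_right) (rule unit_body_integrable[OF A])
    finally show ?thesis .
  qed
  moreover have "(\<integral>y. y \<partial>?DB') = u \<bullet> centroid B + d"
  proof -
    interpret finite_measure "lebesgue_on B"
      using B'(4) by (rule finite_measure_lebesgue_on)
    have int: "integrable (lebesgue_on B) (\<lambda>x. u \<bullet> x)"
      by (rule integrable_inner_right) (rule unit_body_integrable[OF B])
    have "(\<integral>y. y \<partial>?DB') = (\<integral>y. y + d \<partial>?DB)"
      by (rule integral_distr) simp_all
    also have "\<dots> = (\<integral>x. u \<bullet> x + d \<partial>lebesgue_on B)"
      using meas(2) by (rule integral_distr) simp
    also have "\<dots> = (\<integral>x. u \<bullet> x \<partial>lebesgue_on B) + (\<integral>x. d \<partial>lebesgue_on B)"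
      using int by (rule Bochner_Integration.integral_add) simp
    also have "(\<integral>x. u \<bullet> x \<partial>lebesgue_on B) = u \<bullet> centroid B"
      unfolding centroid_def by (rule integral_inner_right) (rule unit_body_integrable[OF B])
    also have "(\<integral>x. d \<partial>lebesgue_on B) = d"
      using B'(3,4) by (simp add: measure_restrict_space)
    finally show ?thesis .
  qed
  ultimately show ?thesis
    by (simp add: inner_diff_right)
qed

text \<open>If \<open>x\<close> is in \<open>A\<close> but \<open>x - c\<close> is not in
  \<open>B\<close>, a separating hyperplane yields a halfspace that misses \<open>B\<close>, while
  its translate by \<open>c\<close> cuts positive volume from \<open>A\<close>.\<close>

lemma unit_body_subset_of_halfspaces:
  fixes A B :: "'a::euclidean_space set"
  assumes A: "unit_body A" and B: "unit_body B"
    and eq: "\<And>u s. u \<noteq> 0 \<Longrightarrow> vol (A \<inter> {x. u \<bullet> x \<le> s}) = vol (B \<inter> {x. u \<bullet> x \<le> s - u \<bullet> c})"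
  shows "A \<subseteq> (\<lambda>x. x + c) ` B"
proof
  note A' = unit_bodyD[OF A] and B' = unit_bodyD[OF B]
  fix x assume "x \<in> A"
  show "x \<in> (\<lambda>x. x + c) ` B"
  proof (rule ccontr)
    assume "x \<notin> (\<lambda>x. x + c) ` B"
    then have "x - c \<notin> B"
      by (force simp: image_iff)
    then obtain u t where ut: "u \<bullet> (x - c) < t" "\<And>y. y \<in> B \<Longrightarrow> t < u \<bullet> y"
      using separating_hyperplane_closed_point[OF B'(2) compact_imp_closed[OF B'(1)]] by metis
    have "B \<noteq> {}"
      using B'(3) by auto
    then have "u \<noteq> 0"
      using ut by force
    have "0 < vol (A \<inter> {y. u \<bullet> y < t + u \<bullet> c})"
      using \<open>x \<in> A\<close> ut(1)
      by (intro vol_Int_open_pos A' open_halfspace_lt) (force simp: inner_diff_right)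
    also have "\<dots> = vol (B \<inter> {y. u \<bullet> y \<le> t})"
      using eq[OF \<open>u \<noteq> 0\<close>, of "t + u \<bullet> c"] vol_halfspace_split(1)[OF A'(4) \<open>u \<noteq> 0\<close>] by simp
    also have "B \<inter> {y. u \<bullet> y \<le> t} = {}"
      using ut(2) by force
    finally show False
      by simp
  qed
qed

proposition unit_bodies_equality_translate:
  fixes A B :: "'a::euclidean_space set"
  assumes A: "unit_body A" and B: "unit_body B" and ab: "a > 0" "b > 0"
    and eq: "vol ((\<lambda>x. a *\<^sub>R x) ` A + (\<lambda>x. b *\<^sub>R x) ` B) \<le> (a + b) ^ DIM('a)"
  shows "\<exists>c. A = (\<lambda>x. x + c) ` B"
proof (intro exI equalityI)
  define c where "c = centroid A - centroid B"
  have shift: "vol (A \<inter> {x. u \<bullet> x \<le> s}) = vol (B \<inter> {x. u \<bullet> x \<le> s - u \<bullet> c})" if "u \<noteq> 0" for u s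
  proof -
    obtain d where d: "\<And>s. vol (A \<inter> {x. u \<bullet> x \<le> s}) = vol (B \<inter> {x. u \<bullet> x \<le> s - d})"
      using halfspace_shift[OF A B \<open>u \<noteq> 0\<close> ab eq] by metis
    then show ?thesis
      using halfspace_shift_centroid[OF A B d] by (simp add: c_def)
  qed
  show "A \<subseteq> (\<lambda>x. x + c) ` B"
    using A B shift by (rule unit_body_subset_of_halfspaces)
  have "B \<subseteq> (\<lambda>x. x + (- c)) ` A"
    by (rule unit_body_subset_of_halfspaces[OF B A]) (simp add: shift)
  then show "(\<lambda>x. x + c) ` B \<subseteq> A"
    by force
qed

section \<open>Homothetic bodies and the equivalence\<close>

lemma minkowski_comb_eq: "minkowski_comb a K b L = (\<lambda>x. a *\<^sub>R x) ` K + (\<lambda>x. b *\<^sub>R x) ` L"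
  by (auto simp: minkowski_comb_def set_plus_def)

text \<open>Convexity gives the forward inclusion: a sum with weights \<open>s\<close> and
  \<open>t\<close> is \<open>s + t\<close> times a weighted average.\<close>

lemma convex_scaleR_add:
  fixes L :: "'a::real_vector set"
  assumes "convex L" "s > 0" "t > 0"
  shows "(\<lambda>x. s *\<^sub>R x) ` L + (\<lambda>x. t *\<^sub>R x) ` L = (\<lambda>x. (s + t) *\<^sub>R x) ` L"
proof (intro equalityI subsetI)
  fix v assume "v \<in> (\<lambda>x. s *\<^sub>R x) ` L + (\<lambda>x. t *\<^sub>R x) ` L"
  then obtain x y where xy: "x \<in> L" "y \<in> L" and v: "v = s *\<^sub>R x + t *\<^sub>R y"
    by (auto simp: set_plus_def)
  let ?z = "(s / (s + t)) *\<^sub>R x + (t / (s + t)) *\<^sub>R y"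
  have "?z \<in> L"
    using assms xy by (intro convexD) (auto simp: add_divide_distrib[symmetric])
  moreover have "v = (s + t) *\<^sub>R ?z"
    using assms v by (simp add: scaleR_add_right)
  ultimately show "v \<in> (\<lambda>x. (s + t) *\<^sub>R x) ` L"
    by blast
qed (auto simp: scaleR_add_left set_plus_def)

text \<open>The combination is itself a homothetic copy of \<open>L\<close>, with ratio
  \<open>(1 - l) * a + l\<close>, so both sides are that ratio times the root of the volume of
  \<open>L\<close>.\<close>

lemma vol_homothetic_comb:
  fixes L :: "'a::euclidean_space set"
  assumes L: "convex L" and "a > 0" "0 < l" "l < 1"
  shows "root DIM('a) (vol (minkowski_comb (1 - l) ((\<lambda>y. a *\<^sub>R y + x) ` L) l L)) =
    (1 - l) * root DIM('a) (vol ((\<lambda>y. a *\<^sub>R y + x) ` L)) + l * root DIM('a) (vol L)"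
proof -
  let ?c = "(1 - l) * a + l"
  have pos: "(1 - l) * a > 0"
    using assms by simp
  have "minkowski_comb (1 - l) ((\<lambda>y. a *\<^sub>R y + x) ` L) l L =
      (\<lambda>y. y + (1 - l) *\<^sub>R x) ` ((\<lambda>y. ((1 - l) * a) *\<^sub>R y) ` L + (\<lambda>y. l *\<^sub>R y) ` L)"
    by (force simp: minkowski_comb_def set_plus_def scaleR_add_right)
  also have "\<dots> = (\<lambda>y. ?c *\<^sub>R y + (1 - l) *\<^sub>R x) ` L"
    unfolding convex_scaleR_add[OF L pos \<open>0 < l\<close>] by (simp add: image_image)
  finally have "vol (minkowski_comb (1 - l) ((\<lambda>y. a *\<^sub>R y + x) ` L) l L) = ?c ^ DIM('a) * vol L"
    using pos \<open>0 < l\<close> by (simp add: measure_lebesgue_affine)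
  moreover have "vol ((\<lambda>y. a *\<^sub>R y + x) ` L) = a ^ DIM('a) * vol L"
    using \<open>a > 0\<close> by (simp add: measure_lebesgue_affine)
  moreover have "root DIM('a) (r ^ DIM('a) * vol L) = r * root DIM('a) (vol L)" if "r > 0" for r
    using that by (simp add: real_root_mult real_root_power_cancel)
  ultimately show ?thesis
    using add_pos_pos[OF pos \<open>0 < l\<close>] \<open>a > 0\<close> by (simp add: distrib_right)
qed

lemma homothetic_of_equality:
  fixes K L :: "'a::euclidean_space set"
  assumes K: "compact K" "convex K" "vol K > 0" and L: "compact L" "convex L" "vol L > 0"
    and l: "0 < l" "l < 1"
    and eq: "root DIM('a) (vol (minkowski_comb (1 - l) K l L)) =
      (1 - l) * root DIM('a) (vol K) + l * root DIM('a) (vol L)"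
  shows "homothetic K L"
proof -
  let ?N = "DIM('a)"
  define k m where "k = root ?N (vol K)" and "m = root ?N (vol L)"
  have km: "k > 0" "m > 0" "k ^ ?N = vol K" "m ^ ?N = vol L"
    using K L by (auto simp: k_def m_def real_root_gt_zero)
  define A B where "A = (\<lambda>x. (1 / k) *\<^sub>R x) ` K" and "B = (\<lambda>x. (1 / m) *\<^sub>R x) ` L"
  have A: "unit_body A" and B: "unit_body B"
    using K L km unfolding unit_body_def A_def B_def
    by (auto simp: vol_scaleR power_divide compact_scaling convex_scaling)
  \<comment> \<open>After normalisation the weights are \<open>(1 - l) * k\<close> and
    \<open>l * m\<close>. Their sum need not be 1, which is why the preceding results allow
    arbitrary positive weights.\<close>
  have "minkowski_comb (1 - l) K l L = (\<lambda>x. ((1 - l) * k) *\<^sub>R x) ` A + (\<lambda>x. (l * m) *\<^sub>R x) ` B"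
    using km by (simp add: minkowski_comb_eq A_def B_def image_image)
  moreover have "vol (minkowski_comb (1 - l) K l L) = ((1 - l) * k + l * m) ^ ?N"
    using eq by (metis DIM_positive k_def m_def measure_nonneg real_root_pow_pos2)
  ultimately have "vol ((\<lambda>x. ((1 - l) * k) *\<^sub>R x) ` A + (\<lambda>x. (l * m) *\<^sub>R x) ` B) \<le> ((1 - l) * k + l * m) ^ ?N"
    by simp
  then obtain c where c: "A = (\<lambda>x. x + c) ` B"
    using unit_bodies_equality_translate[OF A B] km l by (metis diff_gt_0_iff_gt mult_pos_pos)
  have "K = (\<lambda>x. k *\<^sub>R x) ` A"
    using km by (simp add: A_def image_image)
  also have "\<dots> = (\<lambda>y. (k / m) *\<^sub>R y + k *\<^sub>R c) ` L"
    by (simp add: c B_def image_image scaleR_add_right)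
  finally show ?thesis
    using km unfolding homothetic_def by (metis divide_pos_pos)
qed

theorem theorem1p1:
  fixes K L :: "(real ^ 'n) set"
  assumes "compact K" and "convex K" and "interior K \<noteq> {}"
    and "compact L" and "convex L" and "interior L \<noteq> {}"
  shows "(\<exists>l::real. 0 < l \<and> l < 1 \<and>
            measure lebesgue (minkowski_comb (1 - l) K l L) powr (1 / real CARD('n))
              = (1 - l) * measure lebesgue K powr (1 / real CARD('n))
                + l * measure lebesgue L powr (1 / real CARD('n)))
         \<longleftrightarrow> homothetic K L"
proof -
  have root: "vol S powr (1 / real CARD('n)) = root DIM(real ^ 'n) (vol S)" for S :: "(real ^ 'n) set"
    by (simp add: root_powr_inverse)
  have pos: "vol S > 0" if "compact S" "convex S" "interior S \<noteq> {}" for S :: "(real ^ 'n) set"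
    using vol_Int_open_pos[of S UNIV] that by (force simp: lmeasurable_compact)
  show ?thesis
    unfolding root
  proof
    assume "\<exists>l>0. l < 1 \<and> root DIM(real ^ 'n) (vol (minkowski_comb (1 - l) K l L)) =
      (1 - l) * root DIM(real ^ 'n) (vol K) + l * root DIM(real ^ 'n) (vol L)"
    then show "homothetic K L"
      using homothetic_of_equality[OF assms(1,2) pos[OF assms(1-3)] assms(4,5) pos[OF assms(4-6)]] by blast
  next
    assume "homothetic K L"
    then obtain a x where "a > 0" "K = (\<lambda>y. a *\<^sub>R y + x) ` L"
      by (auto simp: homothetic_def)
    \<comment> \<open>For homothetic bodies equality holds at every \<open>l\<close> in the open
      unit interval; \<open>1/2\<close> is chosen.\<close>
    then show "\<exists>l>0. l < 1 \<and> root DIM(real ^ 'n) (vol (minkowski_comb (1 - l) K l L)) =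
      (1 - l) * root DIM(real ^ 'n) (vol K) + l * root DIM(real ^ 'n) (vol L)"
      using vol_homothetic_comb[OF \<open>convex L\<close> \<open>a > 0\<close>, of "1/2" x] by (intro exI[of _ "1/2"]) simp
  qed
qed

end
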